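(* Consider a network (as in the context) operated under a $w$-WMW policy, and let $C$ be its sensitivity constant, i.e., a constant such that for every arrival function $A$, every corresponding queue process $Q$, every $\lambda\succeq0$ and every fluid solution $q$ for $\lambda$ with $q(0)=Q(0)$, one has $\|Q(k)-q(k)\|_2\le C(1+\|\lambda\|+\max_{t<k}\|\sum_{\tau=0}^t(A(\tau)-\lambda)\|_2)$ for all $k\in\mathbb{Z}_+$. Fix an arrival function $A:\mathbb{Z}_+\to\mathbb{R}_+^n$ and $q_0\in\mathbb{R}_+^n$. For $r>0$ let $Q^r(\cdot)$ be the queue length process driven by $A(\cdot)$ with $Q^r(0)=rq_0$, and let $\hat q^r(t)=Q^r(\lfloor rt\rfloor)/r$ for $t\ge0$. Let $q(\cdot)$ be a fluid solution for some $\lambda\in\mathbb{R}_+^n$ with $q(0)=q_0$. Then for any $T>0$, $$\sup_{t\le T}\|\hat q^r(t)-q(t)\|_2\le \frac{C}{r}\max_{t<rT}\Big\|\sum_{\tau=0}^t\big(A(\tau)-\lambda\big)\Big\|_2+O(1/r),$$ where $O(1/r)$ denotes a term bounded by $K/r$ for a constant $K$ not depending on $r$.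
   Context: A network consists of $n$ queues, a routing matrix $R\in\mathbb{R}^{n\times n}$ with nonnegative entries, and a finite set $\mathcal{S}\subset\mathbb{R}_+^n$ of service vectors; standing assumption: for every $\mu\in\mathcal{S}$ and every $i$, the vector obtained from $\mu$ by setting its $i$-th entry to zero belongs to $\mathcal{S}$. A queue length process driven by $A:\mathbb{Z}_+\to\mathbb{R}_+^n$ evolves by $Q(t+1)=Q(t)+A(t)+(R-I)\min(\mu(t),Q(t))$ (componentwise min), where $\mu(t)\in\mathcal{S}$ is the chosen service vector. For $w\in\mathbb{R}_{++}^n$, $W=\mathrm{diag}(w)$, $\mathcal{S}_w(x)=\arg\max_{\mu\in\mathcal{S}}x^TW(I-R)\mu$; the $w$-WMW policy chooses $\mu(t)\in\mathcal{S}_w(Q(t))$ arbitrarily. A fluid solution for $\lambda\in\mathbb{R}_+^n$ (weights $w$) is an absolutely continuous $q:\mathbb{R}_+\to\mathbb{R}_+^n$ for which there exist $s_\mu:\mathbb{R}_+\to[0,1]$ ($\mu\in\mathcal{S}$) and $y:\mathbb{R}_+\to\mathbb{R}_+^n$ with, for a.e. $t$: $\dot q(t)=\lambda+(R-I)(\sum_\mu s_\mu(t)\mu-y(t))$, $\sum_\mu s_\mu(t)=1$, $y_i(t)\le\sum_\mu s_\mu(t)\mu_i$, $q_i(t)>0\Rightarrow y_i(t)=0$, and $\mu\notin\mathcal{S}_w(q(t))\Rightarrow s_\mu(t)=0$. *)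

theory Defs
  imports "HOL-Analysis.Analysis"
begin

text \<open>Vectors in R^n are modelled as real^'n for a finite index type 'n; n x n matrices as real^'n^'n.\<close>

definition nonneg_vec :: "real^'n \<Rightarrow> bool" where
  "nonneg_vec x \<longleftrightarrow> (\<forall>i. 0 \<le> x $ i)"

definition diagm :: "real^'n \<Rightarrow> real^'n^'n" where
  "diagm w = (\<chi> i j. if i = j then w $ i else 0)"

definition vmin :: "real^'n \<Rightarrow> real^'n \<Rightarrow> real^'n" where
  "vmin x y = (\<chi> i. min (x $ i) (y $ i))"

text \<open>Standing assumptions on the network data (R, S).\<close>
definition network :: "real^'n^'n \<Rightarrow> (real^'n) set \<Rightarrow> bool" where
  "network R S \<longleftrightarrow> (\<forall>i j. 0 \<le> R $ i $ j) \<and> finite S \<and> (\<forall>\<mu>\<in>S. nonneg_vec \<mu>) \<and>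
     (\<forall>\<mu>\<in>S. \<forall>i. (\<chi> j. if j = i then 0 else \<mu> $ j) \<in> S)"

text \<open>S_w(x) = argmax over mu in S of x^T W (I - R) mu, with W = diag w.\<close>
definition Sw :: "real^'n^'n \<Rightarrow> (real^'n) set \<Rightarrow> real^'n \<Rightarrow> real^'n \<Rightarrow> (real^'n) set" where
  "Sw R S w x = {\<mu>\<in>S. \<forall>\<nu>\<in>S.
      x \<bullet> (diagm w *v ((mat 1 - R) *v \<nu>)) \<le> x \<bullet> (diagm w *v ((mat 1 - R) *v \<mu>))}"

text \<open>Q is a queue length process driven by A under the w-WMW policy (service vector chosen
  arbitrarily in S_w(Q(t)) at each step).\<close>
definition wmw_process :: "real^'n^'n \<Rightarrow> (real^'n) set \<Rightarrow> real^'n \<Rightarrow>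
    (nat \<Rightarrow> real^'n) \<Rightarrow> (nat \<Rightarrow> real^'n) \<Rightarrow> bool" where
  "wmw_process R S w A Q \<longleftrightarrow>
     (\<forall>t. \<exists>\<mu>\<in>Sw R S w (Q t). Q (Suc t) = Q t + A t + (R - mat 1) *v vmin \<mu> (Q t))"

text \<open>Absolute continuity of f on [0,T].\<close>
definition abs_cont_on_interval :: "(real \<Rightarrow> real^'n) \<Rightarrow> real \<Rightarrow> bool" where
  "abs_cont_on_interval f T \<longleftrightarrow>
     (\<forall>\<epsilon>>0. \<exists>\<delta>>0. \<forall>(m::nat) (a::nat \<Rightarrow> real) b.
        (\<forall>i<m. 0 \<le> a i \<and> a i \<le> b i \<and> b i \<le> T) \<and>
        (\<forall>i<m. \<forall>j<m. i \<noteq> j \<longrightarrow> b i \<le> a j \<or> b j \<le> a i) \<and>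
        (\<Sum>i<m. b i - a i) < \<delta>
        \<longrightarrow> (\<Sum>i<m. norm (f (b i) - f (a i))) < \<epsilon>)"

text \<open>Absolute continuity on R_+ (i.e. on every compact interval [0,T]).\<close>
definition abs_cont_nonneg :: "(real \<Rightarrow> real^'n) \<Rightarrow> bool" where
  "abs_cont_nonneg f \<longleftrightarrow> (\<forall>T\<ge>0. abs_cont_on_interval f T)"

text \<open>Fluid solution for arrival rate lam (weights w).\<close>
definition fluid_solution :: "real^'n^'n \<Rightarrow> (real^'n) set \<Rightarrow> real^'n \<Rightarrow> real^'n \<Rightarrow>
    (real \<Rightarrow> real^'n) \<Rightarrow> bool" where
  "fluid_solution R S w lam q \<longleftrightarrow>
     abs_cont_nonneg q \<and> (\<forall>t\<ge>0. nonneg_vec (q t)) \<and>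
     (\<exists>(s :: real^'n \<Rightarrow> real \<Rightarrow> real) (y :: real \<Rightarrow> real^'n).
        (\<forall>\<mu>\<in>S. \<forall>t\<ge>0. 0 \<le> s \<mu> t \<and> s \<mu> t \<le> 1) \<and>
        (\<forall>t\<ge>0. nonneg_vec (y t)) \<and>
        (\<exists>N. N \<in> null_sets lborel \<and> (\<forall>t. t \<ge> 0 \<and> t \<notin> N \<longrightarrow>
           (q has_vector_derivative
              (lam + (R - mat 1) *v ((\<Sum>\<mu>\<in>S. s \<mu> t *\<^sub>R \<mu>) - y t))) (at t within {0..}) \<and>
           (\<Sum>\<mu>\<in>S. s \<mu> t) = 1 \<and>
           (\<forall>i. y t $ i \<le> (\<Sum>\<mu>\<in>S. s \<mu> t * \<mu> $ i)) \<and>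
           (\<forall>i. q t $ i > 0 \<longrightarrow> y t $ i = 0) \<and>
           (\<forall>\<mu>\<in>S. \<mu> \<notin> Sw R S w (q t) \<longrightarrow> s \<mu> t = 0))))"

text \<open>max_{t < x} || sum_{tau=0}^t (A tau - lam) ||_2, over natural t; taken to be 0 if there
  is no such t (all terms are nonnegative, so inserting 0 does not change a nonempty max).\<close>
definition maxdev :: "(nat \<Rightarrow> real^'n) \<Rightarrow> real^'n \<Rightarrow> real \<Rightarrow> real" where
  "maxdev A lam x = Max (insert 0 {norm (\<Sum>\<tau>\<le>t. A \<tau> - lam) | t::nat. real t < x})"

text \<open>C is a sensitivity constant of the network under the w-WMW policy.\<close>
definition sensitivity_const :: "real^'n^'n \<Rightarrow> (real^'n) set \<Rightarrow> real^'n \<Rightarrow> real \<Rightarrow> bool" where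
  "sensitivity_const R S w C \<longleftrightarrow>
     (\<forall>A Q lam q. (\<forall>t. nonneg_vec (A t)) \<longrightarrow> wmw_process R S w A Q \<longrightarrow> nonneg_vec lam \<longrightarrow>
        fluid_solution R S w lam q \<longrightarrow> q 0 = Q 0 \<longrightarrow>
        (\<forall>k::nat. norm (Q k - q (real k)) \<le> C * (1 + norm lam + maxdev A lam (real k))))"

end

theory Submission
  imports Defs
begin

(* Fluid solutions are invariant under the rescaling q \<mapsto> (1/c) q(a + c \<cdot>) of time and space.
   Applied with a = 0, c = 1/r, the sensitivity bound compares Q^r(k)/r with q(k/r) at the grid
   points k/r.  Between grid points q is Lipschitz, which again follows from the sensitivity
   bound: rescale q so that [s, s + \<delta>] becomes [0, 1] and compare it with one step of a WMW
   process with constant arrivals \<lambda> started at q(s)/\<delta>; that step moves by at most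
   \<parallel>\<lambda>\<parallel> + \<parallel>R - I\<parallel> \<Sum>\<^sub>\<mu> \<parallel>\<mu>\<parallel>, and the process stays within C(1 + \<parallel>\<lambda>\<parallel>) of the fluid. *)

lemma null_sets_lborel_affine_preimage:
  fixes N :: "real set"
  assumes "N \<in> null_sets lborel" and "c > 0"
  shows "{u. a + c * u \<in> N} \<in> null_sets lborel"
proof -
  have N: "N \<in> sets borel" using assms(1) by auto
  have "(\<lambda>u. a + c * u) \<in> borel_measurable borel" by measurable
  from measurable_sets[OF this N] have "{u. a + c * u \<in> N} \<in> sets borel"
    by (simp add: vimage_def)
  moreover have "AE x in lborel. x \<notin> N" using assms(1) AE_not_in by blast
  then have "AE u in lborel. a + c * u \<notin> N"
    using AE_borel_affine[of c "\<lambda>x. x \<notin> N" a] assms(2) N by (simp add: pred_def)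
  ultimately show ?thesis using AE_iff_null_sets[of "{u. a + c * u \<in> N}" lborel] by simp
qed

lemma ex_nonneg_notin_null_set:
  fixes N :: "real set"
  assumes "N \<in> null_sets lborel"
  shows "\<exists>t\<ge>0. t \<notin> N"
proof (rule ccontr)
  assume "\<not> (\<exists>t\<ge>0. t \<notin> N)"
  then have "{0..1} \<subseteq> N" by auto
  then have "{0..1::real} \<in> null_sets lborel" using null_sets_subset[OF assms] by auto
  then show False by (auto dest: null_setsD1)
qed

lemma Sw_scaleR:
  assumes "c > 0"
  shows "Sw R S w (c *\<^sub>R x) = Sw R S w x"
  using assms by (simp add: Sw_def inner_scaleR_left mult_le_cancel_left_pos)

lemma Sw_nonempty:
  assumes "finite S" and "S \<noteq> {}"
  shows "Sw R S w x \<noteq> {}"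
proof -
  define f where "f \<mu> = x \<bullet> (diagm w *v ((mat 1 - R) *v \<mu>))" for \<mu>
  have "Max (f ` S) \<in> f ` S" using assms by simp
  then obtain \<mu> where "\<mu> \<in> S" and "f \<mu> = Max (f ` S)" by auto
  then have "\<mu> \<in> Sw R S w x" using assms unfolding Sw_def f_def[symmetric] by simp
  then show ?thesis by blast
qed

lemma wmw_process_exists:
  assumes "finite S" and "S \<noteq> {}"
  shows "\<exists>Q. wmw_process R S w A Q \<and> Q 0 = x0"
proof -
  define Q where "Q = rec_nat x0 (\<lambda>t x. x + A t + (R - mat 1) *v vmin (SOME \<mu>. \<mu> \<in> Sw R S w x) x)"
  have "wmw_process R S w A Q"
    unfolding wmw_process_def
  proof
    fix t
    have "(SOME \<mu>. \<mu> \<in> Sw R S w (Q t)) \<in> Sw R S w (Q t)"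
      using Sw_nonempty[OF assms] by (simp add: some_in_eq)
    then show "\<exists>\<mu>\<in>Sw R S w (Q t). Q (Suc t) = Q t + A t + (R - mat 1) *v vmin \<mu> (Q t)"
      unfolding Q_def by auto
  qed
  moreover have "Q 0 = x0" unfolding Q_def by simp
  ultimately show ?thesis by blast
qed

lemma norm_vmin_le:
  assumes "nonneg_vec \<mu>" and "nonneg_vec x"
  shows "norm (vmin \<mu> x) \<le> norm \<mu>"
  using assms by (intro norm_le_componentwise_cart) (auto simp: vmin_def nonneg_vec_def)

lemma wmw_process_step_bound:
  assumes "network R S" and "wmw_process R S w A Q" and "nonneg_vec (Q t)"
  shows "norm (Q (Suc t) - Q t) \<le> norm (A t) + onorm ((*v) (R - mat 1)) * (\<Sum>\<mu>\<in>S. norm \<mu>)"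
proof -
  obtain \<mu> where "\<mu> \<in> S" and step: "Q (Suc t) = Q t + A t + (R - mat 1) *v vmin \<mu> (Q t)"
    using assms(2) unfolding wmw_process_def Sw_def by blast
  have "finite S" and "nonneg_vec \<mu>" using assms(1) \<open>\<mu> \<in> S\<close> unfolding network_def by auto
  have "norm ((R - mat 1) *v vmin \<mu> (Q t)) \<le> onorm ((*v) (R - mat 1)) * norm (vmin \<mu> (Q t))"
    by (rule onorm) simp
  also have "\<dots> \<le> onorm ((*v) (R - mat 1)) * norm \<mu>"
    using norm_vmin_le[OF \<open>nonneg_vec \<mu>\<close> assms(3)] by (simp add: mult_left_mono onorm_pos_le)
  also have "\<dots> \<le> onorm ((*v) (R - mat 1)) * (\<Sum>\<mu>\<in>S. norm \<mu>)"
    using \<open>finite S\<close> \<open>\<mu> \<in> S\<close> by (intro mult_left_mono member_le_sum onorm_pos_le) auto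
  finally have "norm ((R - mat 1) *v vmin \<mu> (Q t)) \<le> onorm ((*v) (R - mat 1)) * (\<Sum>\<mu>\<in>S. norm \<mu>)" .
  moreover have "norm (Q (Suc t) - Q t) \<le> norm (A t) + norm ((R - mat 1) *v vmin \<mu> (Q t))"
    using step norm_triangle_ineq by (simp add: add.assoc)
  ultimately show ?thesis by linarith
qed

definition fluid_equations ::
  "real^'n^'n \<Rightarrow> (real^'n) set \<Rightarrow> real^'n \<Rightarrow> real^'n \<Rightarrow> (real \<Rightarrow> real^'n) \<Rightarrow>
   (real^'n \<Rightarrow> real \<Rightarrow> real) \<Rightarrow> (real \<Rightarrow> real^'n) \<Rightarrow> real \<Rightarrow> bool" where
  "fluid_equations R S w lam q s y t \<longleftrightarrow>
     (q has_vector_derivative lam + (R - mat 1) *v ((\<Sum>\<mu>\<in>S. s \<mu> t *\<^sub>R \<mu>) - y t)) (at t within {0..}) \<and>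
     (\<Sum>\<mu>\<in>S. s \<mu> t) = 1 \<and>
     (\<forall>i. y t $ i \<le> (\<Sum>\<mu>\<in>S. s \<mu> t * \<mu> $ i)) \<and>
     (\<forall>i. q t $ i > 0 \<longrightarrow> y t $ i = 0) \<and>
     (\<forall>\<mu>\<in>S. \<mu> \<notin> Sw R S w (q t) \<longrightarrow> s \<mu> t = 0)"

lemma fluid_solution_iff:
  "fluid_solution R S w lam q \<longleftrightarrow>
     abs_cont_nonneg q \<and> (\<forall>t\<ge>0. nonneg_vec (q t)) \<and>
     (\<exists>s y. (\<forall>\<mu>\<in>S. \<forall>t\<ge>0. 0 \<le> s \<mu> t \<and> s \<mu> t \<le> 1) \<and> (\<forall>t\<ge>0. nonneg_vec (y t)) \<and>
        (\<exists>N. N \<in> null_sets lborel \<and> (\<forall>t. t \<ge> 0 \<and> t \<notin> N \<longrightarrow> fluid_equations R S w lam q s y t)))"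
  unfolding fluid_solution_def fluid_equations_def ..

lemma fluid_solution_service_set_nonempty:
  assumes "fluid_solution R S w lam q"
  shows "S \<noteq> {}"
proof -
  obtain s y N where "N \<in> null_sets lborel"
    and eqs: "\<And>t. t \<ge> 0 \<Longrightarrow> t \<notin> N \<Longrightarrow> fluid_equations R S w lam q s y t"
    using assms unfolding fluid_solution_iff by blast
  then obtain t where "fluid_equations R S w lam q s y t"
    using ex_nonneg_notin_null_set by blast
  then have "(\<Sum>\<mu>\<in>S. s \<mu> t) = 1" unfolding fluid_equations_def by blast
  then show ?thesis by auto
qed

lemma has_vector_derivative_rescale:
  fixes q :: "real \<Rightarrow> 'a::real_normed_vector"
  assumes "(q has_vector_derivative D) (at (a + c * u) within {0..})" and "a \<ge> 0" and "c > 0"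
  shows "((\<lambda>u. (1/c) *\<^sub>R q (a + c * u)) has_vector_derivative D) (at u within {0..})"
proof -
  have "((\<lambda>u. a + c * u) has_vector_derivative c) (at u within {0..})"
    by (auto intro!: derivative_eq_intros simp flip: has_real_derivative_iff_has_vector_derivative)
  moreover have "(q has_vector_derivative D) (at (a + c * u) within (\<lambda>u. a + c * u) ` {0..})"
    using assms(1) by (rule has_vector_derivative_within_subset) (use assms(2,3) in auto)
  ultimately have "((\<lambda>u. q (a + c * u)) has_vector_derivative c *\<^sub>R D) (at u within {0..})"
    using vector_diff_chain_within by (simp add: o_def)
  then have "((\<lambda>u. (1/c) *\<^sub>R q (a + c * u)) has_vector_derivative
      (1/c) *\<^sub>R (c *\<^sub>R D) + 0 *\<^sub>R q (a + c * u)) (at u within {0..})"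
    by (rule has_vector_derivative_scaleR[OF DERIV_const])
  then show ?thesis using assms(3) by simp
qed

lemma fluid_equations_rescale:
  assumes "fluid_equations R S w lam q s y (a + c * u)" and "a \<ge> 0" and "c > 0"
  shows "fluid_equations R S w lam (\<lambda>u. (1/c) *\<^sub>R q (a + c * u))
           (\<lambda>\<mu> u. s \<mu> (a + c * u)) (\<lambda>u. y (a + c * u)) u"
proof -
  have "Sw R S w ((1/c) *\<^sub>R q (a + c * u)) = Sw R S w (q (a + c * u))"
    using assms(3) by (simp add: Sw_scaleR)
  moreover have "((1/c) *\<^sub>R q (a + c * u)) $ i > 0 \<longleftrightarrow> q (a + c * u) $ i > 0" for i
    using assms(3) by (simp add: zero_less_divide_iff)
  ultimately show ?thesis
    using assms has_vector_derivative_rescale unfolding fluid_equations_def by auto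
qed

lemma abs_cont_on_interval_rescale:
  assumes ac: "abs_cont_on_interval q (a + c * T)" and "a \<ge> 0" and "c > 0"
  shows "abs_cont_on_interval (\<lambda>u. (1/c) *\<^sub>R q (a + c * u)) T"
  unfolding abs_cont_on_interval_def
proof (intro allI impI)
  fix \<epsilon> :: real
  assume "\<epsilon> > 0"
  then have "c * \<epsilon> > 0" using \<open>c > 0\<close> by simp
  from ac[unfolded abs_cont_on_interval_def, rule_format, OF this]
  obtain \<delta> where "\<delta> > 0" and \<delta>: "\<forall>(m::nat) a' b. (\<forall>i<m. 0 \<le> a' i \<and> a' i \<le> b i \<and> b i \<le> a + c * T) \<and>
      (\<forall>i<m. \<forall>j<m. i \<noteq> j \<longrightarrow> b i \<le> a' j \<or> b j \<le> a' i) \<and> (\<Sum>i<m. b i - a' i) < \<delta> \<longrightarrow>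
      (\<Sum>i<m. norm (q (b i) - q (a' i))) < c * \<epsilon>"
    by blast
  show "\<exists>\<delta>>0. \<forall>(m::nat) a' b. (\<forall>i<m. 0 \<le> a' i \<and> a' i \<le> b i \<and> b i \<le> T) \<and>
      (\<forall>i<m. \<forall>j<m. i \<noteq> j \<longrightarrow> b i \<le> a' j \<or> b j \<le> a' i) \<and> (\<Sum>i<m. b i - a' i) < \<delta> \<longrightarrow>
      (\<Sum>i<m. norm ((1/c) *\<^sub>R q (a + c * b i) - (1/c) *\<^sub>R q (a + c * a' i))) < \<epsilon>"
  proof (intro exI[of _ "\<delta> / c"] conjI allI impI; (elim conjE)?)
    show "\<delta> / c > 0" using \<open>\<delta> > 0\<close> \<open>c > 0\<close> by simp
    fix m :: nat and a' b :: "nat \<Rightarrow> real"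
    assume inside: "\<forall>i<m. 0 \<le> a' i \<and> a' i \<le> b i \<and> b i \<le> T"
      and disjoint: "\<forall>i<m. \<forall>j<m. i \<noteq> j \<longrightarrow> b i \<le> a' j \<or> b j \<le> a' i"
      and short: "(\<Sum>i<m. b i - a' i) < \<delta> / c"
    have "(\<Sum>i<m. (a + c * b i) - (a + c * a' i)) = c * (\<Sum>i<m. b i - a' i)"
      by (simp add: sum_distrib_left algebra_simps)
    also have "\<dots> < \<delta>" using short \<open>c > 0\<close> by (simp add: field_simps)
    finally have "(\<Sum>i<m. norm (q (a + c * b i) - q (a + c * a' i))) < c * \<epsilon>"
      using inside disjoint \<open>a \<ge> 0\<close> \<open>c > 0\<close>
      by (intro \<delta>[rule_format] conjI) (auto simp: mult_left_mono)
    moreover have "(\<Sum>i<m. norm ((1/c) *\<^sub>R q (a + c * b i) - (1/c) *\<^sub>R q (a + c * a' i)))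
        = (\<Sum>i<m. norm (q (a + c * b i) - q (a + c * a' i))) / c"
      using \<open>c > 0\<close> by (simp add: sum_divide_distrib flip: scaleR_diff_right)
    ultimately show "(\<Sum>i<m. norm ((1/c) *\<^sub>R q (a + c * b i) - (1/c) *\<^sub>R q (a + c * a' i))) < \<epsilon>"
      using \<open>c > 0\<close> by (simp add: pos_divide_less_eq mult.commute)
  qed
qed

lemma fluid_solution_rescale:
  assumes "fluid_solution R S w lam q" and "a \<ge> 0" and "c > 0"
  shows "fluid_solution R S w lam (\<lambda>u. (1/c) *\<^sub>R q (a + c * u))"
proof -
  obtain s y N where q: "abs_cont_nonneg q" "\<forall>t\<ge>0. nonneg_vec (q t)"
    and s: "\<forall>\<mu>\<in>S. \<forall>t\<ge>0. 0 \<le> s \<mu> t \<and> s \<mu> t \<le> 1" and y: "\<forall>t\<ge>0. nonneg_vec (y t)"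
    and N: "N \<in> null_sets lborel"
    and eqs: "\<forall>t. t \<ge> 0 \<and> t \<notin> N \<longrightarrow> fluid_equations R S w lam q s y t"
    using assms(1) unfolding fluid_solution_iff by blast
  have shifted: "a + c * u \<ge> 0" if "u \<ge> 0" for u using that assms(2,3) by simp
  show ?thesis
    unfolding fluid_solution_iff
  proof (intro conjI exI[of _ "\<lambda>\<mu> u. s \<mu> (a + c * u)"] exI[of _ "\<lambda>u. y (a + c * u)"]
      exI[of _ "{u. a + c * u \<in> N}"])
    show "abs_cont_nonneg (\<lambda>u. (1/c) *\<^sub>R q (a + c * u))"
      using q(1) shifted assms(2,3) abs_cont_on_interval_rescale
      unfolding abs_cont_nonneg_def by blast
    show "\<forall>u\<ge>0. nonneg_vec ((1/c) *\<^sub>R q (a + c * u))"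
      using q(2) shifted assms(3) by (simp add: nonneg_vec_def)
    show "\<forall>\<mu>\<in>S. \<forall>u\<ge>0. 0 \<le> s \<mu> (a + c * u) \<and> s \<mu> (a + c * u) \<le> 1"
      using s shifted by blast
    show "\<forall>u\<ge>0. nonneg_vec (y (a + c * u))"
      using y shifted by blast
    show "{u. a + c * u \<in> N} \<in> null_sets lborel"
      using N assms(3) by (rule null_sets_lborel_affine_preimage)
    show "\<forall>u. u \<ge> 0 \<and> u \<notin> {u. a + c * u \<in> N} \<longrightarrow> fluid_equations R S w lam
        (\<lambda>u. (1/c) *\<^sub>R q (a + c * u)) (\<lambda>\<mu> u. s \<mu> (a + c * u)) (\<lambda>u. y (a + c * u)) u"
      using assms(2,3) by (auto intro!: fluid_equations_rescale eqs[rule_format] shifted)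
  qed
qed

lemma maxdev_const_arrivals: "maxdev (\<lambda>_. lam) lam x = 0"
  unfolding maxdev_def by (rule Max_eqI) (auto intro: finite_subset[of _ "{0}"])

lemma maxdev_mono:
  assumes "x \<le> y"
  shows "maxdev A lam x \<le> maxdev A lam y"
proof -
  have "{t::nat. real t < y} \<subseteq> {..nat \<lceil>y\<rceil>}" by (auto, linarith)
  then have "finite ((\<lambda>t. norm (\<Sum>\<tau>\<le>t. A \<tau> - lam)) ` {t::nat. real t < y})"
    using finite_subset by blast
  then show ?thesis
    unfolding maxdev_def using assms by (intro Max_mono) (auto simp: setcompr_eq_image)
qed

lemma sensitivity_constD:
  assumes "sensitivity_const R S w C" and "\<forall>t. nonneg_vec (A t)" and "wmw_process R S w A Q"
    and "nonneg_vec lam" and "fluid_solution R S w lam q" and "q 0 = Q 0"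
  shows "norm (Q k - q (real k)) \<le> C * (1 + norm lam + maxdev A lam (real k))"
  using assms unfolding sensitivity_const_def by blast

lemma sensitivity_const_nonneg:
  assumes "network R S" and "sensitivity_const R S w C" and "nonneg_vec lam"
    and "fluid_solution R S w lam q"
  shows "C \<ge> 0"
proof -
  have "finite S" using assms(1) unfolding network_def by blast
  then obtain Q where Q: "wmw_process R S w (\<lambda>_. lam) Q" "Q 0 = q 0"
    using wmw_process_exists fluid_solution_service_set_nonempty[OF assms(4)] by blast
  have "norm (Q 0 - q 0) \<le> C * (1 + norm lam)"
    using sensitivity_constD[OF assms(2) _ Q(1) assms(3,4), of 0] Q(2) assms(3)
    by (simp add: maxdev_const_arrivals)
  then have "0 \<le> C * (1 + norm lam)" using Q(2) by simp
  then show ?thesis using norm_ge_zero[of lam] by (auto simp: zero_le_mult_iff)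
qed

definition fluid_speed_bound :: "real^'n^'n \<Rightarrow> (real^'n) set \<Rightarrow> real \<Rightarrow> real^'n \<Rightarrow> real" where
  "fluid_speed_bound R S C lam =
     C * (1 + norm lam) + norm lam + onorm ((*v) (R - mat 1)) * (\<Sum>\<mu>\<in>S. norm \<mu>)"

lemma fluid_speed_bound_nonneg: "C \<ge> 0 \<Longrightarrow> fluid_speed_bound R S C lam \<ge> 0"
  unfolding fluid_speed_bound_def
  by (intro add_nonneg_nonneg mult_nonneg_nonneg onorm_pos_le sum_nonneg) auto

lemma fluid_solution_lipschitz:
  assumes net: "network R S" and sc: "sensitivity_const R S w C" and lam: "nonneg_vec lam"
    and fs: "fluid_solution R S w lam q" and "0 \<le> s" and "s \<le> t"
  shows "norm (q t - q s) \<le> (t - s) * fluid_speed_bound R S C lam"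
proof (cases "s = t")
  case False
  define \<delta> where "\<delta> = t - s"
  have "\<delta> > 0" using \<open>s \<le> t\<close> False unfolding \<delta>_def by simp
  define p where "p = (\<lambda>u. (1/\<delta>) *\<^sub>R q (s + \<delta> * u))"
  have fp: "fluid_solution R S w lam p"
    unfolding p_def using fs \<open>0 \<le> s\<close> \<open>\<delta> > 0\<close> by (rule fluid_solution_rescale)
  have "finite S" using net unfolding network_def by blast
  then obtain Q where Q: "wmw_process R S w (\<lambda>_. lam) Q" "Q 0 = p 0"
    using wmw_process_exists fluid_solution_service_set_nonempty[OF fs] by blast
  have "norm (Q 1 - p 1) \<le> C * (1 + norm lam)"
    using sensitivity_constD[OF sc _ Q(1) lam fp, of 1] Q(2) lam
    by (simp add: maxdev_const_arrivals)
  moreover have "nonneg_vec (Q 0)" using fp Q(2) unfolding fluid_solution_def by simp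
  then have "norm (Q 1 - Q 0) \<le> norm lam + onorm ((*v) (R - mat 1)) * (\<Sum>\<mu>\<in>S. norm \<mu>)"
    using wmw_process_step_bound[OF net Q(1)] by simp
  ultimately have "norm (p 1 - p 0) \<le> fluid_speed_bound R S C lam"
    using Q(2) norm_triangle_ineq4[of "Q 1 - p 1" "Q 1 - Q 0"]
    unfolding fluid_speed_bound_def by (simp add: norm_minus_commute)
  moreover have "p 1 - p 0 = (1/\<delta>) *\<^sub>R (q t - q s)"
    unfolding p_def \<delta>_def by (simp add: scaleR_diff_right)
  ultimately show ?thesis
    using \<open>\<delta> > 0\<close> unfolding \<delta>_def by (simp add: divide_le_eq mult.commute)
qed simp

lemma fluid_solution_floor_grid_error:
  assumes net: "network R S" and sc: "sensitivity_const R S w C" and lam: "nonneg_vec lam"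
    and fs: "fluid_solution R S w lam q" and "r > 0" and "t \<ge> 0"
  shows "norm (q (real (nat \<lfloor>r * t\<rfloor>) / r) - q t) \<le> fluid_speed_bound R S C lam / r"
proof -
  let ?k = "real (nat \<lfloor>r * t\<rfloor>)"
  have "0 \<le> r * t" using assms by simp
  then have "?k \<le> r * t" and "r * t - ?k \<le> 1" by linarith+
  then have "?k / r \<le> t" using \<open>r > 0\<close> by (simp add: pos_divide_le_eq mult.commute)
  have "t - ?k / r = (r * t - ?k) / r" using \<open>r > 0\<close> by (simp add: field_simps)
  also have "\<dots> \<le> 1 / r" using \<open>r * t - ?k \<le> 1\<close> \<open>r > 0\<close> by (intro divide_right_mono) auto
  finally have "t - ?k / r \<le> 1 / r" .
  have "norm (q t - q (?k / r)) \<le> (t - ?k / r) * fluid_speed_bound R S C lam"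
    using fluid_solution_lipschitz[OF net sc lam fs] \<open>?k / r \<le> t\<close> \<open>r > 0\<close> by simp
  also have "\<dots> \<le> fluid_speed_bound R S C lam / r"
    using \<open>t - ?k / r \<le> 1 / r\<close> fluid_speed_bound_nonneg[OF sensitivity_const_nonneg[OF net sc lam fs]]
      mult_right_mono by fastforce
  finally show ?thesis by (simp add: norm_minus_commute)
qed

lemma scaled_wmw_process_grid_error:
  assumes net: "network R S" and sc: "sensitivity_const R S w C" and A: "\<forall>t. nonneg_vec (A t)"
    and lam: "nonneg_vec lam" and fs: "fluid_solution R S w lam q"
    and Q: "wmw_process R S w A Q" "Q 0 = r *\<^sub>R q 0" and "r > 0" and "real k \<le> x"
  shows "norm (Q k /\<^sub>R r - q (real k / r)) \<le> C / r * (1 + norm lam + maxdev A lam x)"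
proof -
  \<comment> \<open>p u = r q(u/r), in the form that fluid_solution_rescale produces\<close>
  define p where "p = (\<lambda>u. (1 / (1/r)) *\<^sub>R q (0 + (1/r) * u))"
  have "fluid_solution R S w lam p"
    unfolding p_def using fs by (rule fluid_solution_rescale) (use \<open>r > 0\<close> in auto)
  moreover have "p 0 = Q 0" using Q(2) unfolding p_def by simp
  ultimately have "norm (Q k - p (real k)) \<le> C * (1 + norm lam + maxdev A lam (real k))"
    using sensitivity_constD[OF sc A Q(1) lam] by blast
  also have "\<dots> \<le> C * (1 + norm lam + maxdev A lam x)"
    using maxdev_mono[OF \<open>real k \<le> x\<close>] sensitivity_const_nonneg[OF net sc lam fs]
    by (intro mult_left_mono) auto
  moreover have "Q k /\<^sub>R r - q (real k / r) = (1/r) *\<^sub>R (Q k - p (real k))"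
    using \<open>r > 0\<close> unfolding p_def by (simp add: scaleR_diff_right inverse_eq_divide)
  ultimately show ?thesis
    using \<open>r > 0\<close> by (simp add: divide_right_mono)
qed

theorem corollary1:
  fixes R :: "real^'n^'n" and S :: "(real^'n) set" and w :: "real^'n" and C :: real
    and A :: "nat \<Rightarrow> real^'n" and q0 lam :: "real^'n" and q :: "real \<Rightarrow> real^'n" and T :: real
  assumes "network R S"
    and "\<forall>i. 0 < w $ i"
    and "sensitivity_const R S w C"
    and "\<forall>t. nonneg_vec (A t)"
    and "nonneg_vec q0"
    and "nonneg_vec lam"
    and "fluid_solution R S w lam q"
    and "q 0 = q0"
    and "T > 0"
  shows "\<exists>K. \<forall>r>0. \<forall>Q. wmw_process R S w A Q \<and> Q 0 = r *\<^sub>R q0 \<longrightarrow>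
           (\<forall>t\<in>{0..T}. norm (Q (nat \<lfloor>r * t\<rfloor>) /\<^sub>R r - q t)
                          \<le> C / r * maxdev A lam (r * T) + K / r)"
proof -
  let ?L = "fluid_speed_bound R S C lam"
  show ?thesis
  proof (intro exI[of _ "C * (1 + norm lam) + ?L"] allI impI ballI)
    fix r t :: real and Q
    assume "r > 0" and Q: "wmw_process R S w A Q \<and> Q 0 = r *\<^sub>R q0" and t: "t \<in> {0..T}"
    define k where "k = nat \<lfloor>r * t\<rfloor>"
    have "0 \<le> r * t" and "r * t \<le> r * T" using \<open>r > 0\<close> t by (simp_all add: mult_left_mono)
    then have "real k \<le> r * T" unfolding k_def by linarith
    then have "norm (Q k /\<^sub>R r - q (real k / r)) \<le> C / r * (1 + norm lam + maxdev A lam (r * T))"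
      using scaled_wmw_process_grid_error[OF assms(1,3,4,6,7)] Q assms(8) \<open>r > 0\<close> by blast
    moreover have "norm (q (real k / r) - q t) \<le> ?L / r"
      unfolding k_def using fluid_solution_floor_grid_error[OF assms(1,3,6,7) \<open>r > 0\<close>] t by simp
    ultimately have "norm (Q k /\<^sub>R r - q t) \<le> C / r * (1 + norm lam + maxdev A lam (r * T)) + ?L / r"
      by (rule norm_diff_triangle_le)
    also have "\<dots> = C / r * maxdev A lam (r * T) + (C * (1 + norm lam) + ?L) / r"
      by (simp add: add_divide_distrib algebra_simps)
    finally show "norm (Q (nat \<lfloor>r * t\<rfloor>) /\<^sub>R r - q t) \<le>
        C / r * maxdev A lam (r * T) + (C * (1 + norm lam) + ?L) / r"
      unfolding k_def .
  qed
qed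

end
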